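(* Let $m=m(n)=o(n^2)$ and let $\mathcal{P}$ be the set of graphs on $[n]$ that contain a bipartite subgraph with $m$ edges. Then in both the pre-positional and the post-positional semi-random graph processes, the minimum number of rounds required to construct a graph in $\mathcal{P}$ is a.a.s. $(1+o(1))m$; that is, for every strategy a.a.s. at least $m$ rounds are needed, and there is a strategy that a.a.s. succeeds within $(1+o(1))m$ rounds.
   Context: Semi-random graph processes on $[n]$: $G_0$ is empty; in round $t$, $u_t$ is uniform on $[n]$, the player chooses $v_t$, and the edge $u_tv_t$ is added (loops/multi-edges allowed; properties refer to the underlying simple graph, so multiple edges count once). Post-positional: $v_t$ may depend on the history and on $u_t$. Pre-positional: $v_t$ depends only on the history, not on $u_t$. A.a.s. means with probability tending to $1$ as $n\to\infty$. *)

theory Defs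
  imports "HOL-Probability.Probability" "HOL-Library.Landau_Symbols"
begin

section \<open>Graphs and bipartite subgraphs\<close>

text \<open>A graph is a pair of a vertex set and an edge set; edges are two-element sets, so
  graphs are simple.\<close>

type_synonym graph = "nat set \<times> nat set set"

definition simple_graph :: "graph \<Rightarrow> bool" where
  "simple_graph G \<longleftrightarrow> (\<forall>e\<in>snd G. \<exists>x\<in>fst G. \<exists>y\<in>fst G. x \<noteq> y \<and> e = {x, y})"

definition subgraph :: "graph \<Rightarrow> graph \<Rightarrow> bool" where
  "subgraph H G \<longleftrightarrow> simple_graph H \<and> simple_graph G \<and> fst H \<subseteq> fst G \<and> snd H \<subseteq> snd G"

definition bipartite :: "graph \<Rightarrow> bool" where
  "bipartite G \<longleftrightarrow> simple_graph G \<and>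
     (\<exists>A B. A \<union> B = fst G \<and> A \<inter> B = {} \<and> (\<forall>e\<in>snd G. \<exists>a\<in>A. \<exists>b\<in>B. e = {a, b}))"

definition has_bipartite_subgraph :: "nat \<Rightarrow> nat \<Rightarrow> graph set" where
  "has_bipartite_subgraph n m =
     {G. simple_graph G \<and> fst G = {1..n} \<and>
         (\<exists>H. subgraph H G \<and> bipartite H \<and> card (snd H) = m)}"

section \<open>Strategies\<close>

text \<open>A history lists the pairs \<open>(u\<^sub>s, v\<^sub>s)\<close> of the rounds played so far, the earliest round first.
  Given a history and the vertex \<open>u\<close> offered in the current round, a strategy yields the
  distribution of the player's choice \<open>v\<close>, i.e. the player may randomise; the deterministic
  strategies are those all of whose distributions are point masses. Values of a strategy outside
  of \<open>[n]\<close> are irrelevant and hence not restricted.\<close>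

type_synonym history = "(nat \<times> nat) list"
type_synonym strategy = "history \<Rightarrow> nat \<Rightarrow> nat pmf"

definition post_positional :: "nat \<Rightarrow> strategy set" where
  "post_positional n =
     {S. \<forall>h u. set h \<subseteq> {1..n} \<times> {1..n} \<longrightarrow> u \<in> {1..n} \<longrightarrow> set_pmf (S h u) \<subseteq> {1..n}}"

definition pre_positional :: "nat \<Rightarrow> strategy set" where
  "pre_positional n = {S \<in> post_positional n. \<exists>f. \<forall>h u. S h u = f h}"

definition deterministic :: "strategy \<Rightarrow> bool" where
  "deterministic S \<longleftrightarrow> (\<forall>h u. \<exists>v. S h u = return_pmf v)"

section \<open>The semi-random graph process\<close>

text \<open>For \<open>n = 0\<close> the vertex \<open>u\<close> has an unspecified distribution; only large \<open>n\<close> matter below.\<close>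

definition next_round :: "nat \<Rightarrow> strategy \<Rightarrow> history \<Rightarrow> (nat \<times> nat) pmf" where
  "next_round n S h =
     do {u \<leftarrow> pmf_of_set {1..n}; v \<leftarrow> S h u; return_pmf (u, v)}"

text \<open>A trajectory \<open>\<omega>\<close> assigns the pair \<open>(u, v)\<close> of round \<open>t + 1\<close> to \<open>t\<close>. The law of the
  trajectory is the one that the Ionescu-Tulcea theorem constructs from the conditional laws
  of the rounds given their histories.\<close>

definition round_kernel :: "nat \<Rightarrow> strategy \<Rightarrow> nat \<Rightarrow> (nat \<Rightarrow> nat \<times> nat) \<Rightarrow> (nat \<times> nat) measure" where
  "round_kernel n S t \<omega> = measure_pmf (next_round n S (map \<omega> [0..<t]))"

lemma Ionescu_Tulcea_round_kernel:
  "Ionescu_Tulcea (round_kernel n S) (\<lambda>_. count_space UNIV)"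
proof (rule Ionescu_Tulcea.intro)
  fix t :: nat
  have sets_eq: "sets (PiM {0..<t} (\<lambda>_. count_space (UNIV :: (nat \<times> nat) set)))
      = sets (count_space (PiE {0..<t} (\<lambda>_. UNIV)))"
    by (subst count_space_PiM_finite) auto
  have "round_kernel n S t \<in> measurable (count_space (PiE {0..<t} (\<lambda>_. UNIV)))
      (subprob_algebra (count_space UNIV))"
    by (auto simp: round_kernel_def space_subprob_algebra measure_pmf.subprob_space_axioms)
  then show "round_kernel n S t \<in> measurable (PiM {0..<t} (\<lambda>_. count_space UNIV))
      (subprob_algebra (count_space UNIV))"
    by (simp only: measurable_cong_sets[OF sets_eq refl])
next
  fix t :: nat and \<omega> :: "nat \<Rightarrow> nat \<times> nat"
  show "prob_space (round_kernel n S t \<omega>)"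
    by (simp add: round_kernel_def measure_pmf.prob_space_axioms)
qed

interpretation semi_random: Ionescu_Tulcea "round_kernel n S" "\<lambda>_. count_space UNIV" for n S
  by (rule Ionescu_Tulcea_round_kernel)

definition semi_random_process :: "nat \<Rightarrow> strategy \<Rightarrow> (nat \<Rightarrow> nat \<times> nat) measure" where
  "semi_random_process n S = semi_random.PF.lim n S"

text \<open>The simple graph underlying \<open>G\<^sub>t\<close>: loops are dropped and multiple edges are merged.\<close>

definition graph_after :: "nat \<Rightarrow> nat \<Rightarrow> (nat \<Rightarrow> nat \<times> nat) \<Rightarrow> graph" where
  "graph_after n t \<omega> =
     ({1..n}, {{fst (\<omega> s), snd (\<omega> s)} | s. s < t \<and> fst (\<omega> s) \<noteq> snd (\<omega> s)})"

text \<open>The number of rounds is \<open>\<infinity>\<close> if the property is never attained.\<close>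

definition rounds_needed :: "nat \<Rightarrow> graph set \<Rightarrow> (nat \<Rightarrow> nat \<times> nat) \<Rightarrow> enat" where
  "rounds_needed n P \<omega> = Inf (enat ` {t. graph_after n t \<omega> \<in> P})"

text \<open>The event \<open>E n\<close> for the process on \<open>[n]\<close> holds a.a.s. when \<open>S n\<close> is played.\<close>

definition aas :: "(nat \<Rightarrow> strategy) \<Rightarrow> (nat \<Rightarrow> (nat \<Rightarrow> nat \<times> nat) \<Rightarrow> bool) \<Rightarrow> bool" where
  "aas S E \<longleftrightarrow>
     (\<lambda>n. measure (semi_random_process n (S n))
            {\<omega> \<in> space (semi_random_process n (S n)). E n \<omega>}) \<longlonglongrightarrow> 1"

end

theory Submission
  imports Defs
begin

text \<open>The lower bound is immediate, since \<open>t\<close> rounds create at most \<open>t\<close> edges. For the upper bound,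
  declare about \<open>k = \<surd>m\<close> vertices to be hubs and choose them cyclically, ignoring \<open>u\<^sub>t\<close>. A round
  contributes a new edge between the hubs and the other vertices unless \<open>u\<^sub>t\<close> is a hub or was already
  offered in one of the at most \<open>t / k\<close> earlier rounds with the same hub. Whatever the history, the
  probability of this among the first \<open>2 m\<close> rounds is at most \<open>\<delta> = (3 \<surd>m + 1) / n = o(1)\<close>. By Markov's
  inequality, the number of wasted rounds among the first \<open>(1 + \<surd>\<delta>) m\<close> exceeds \<open>\<surd>\<delta> m\<close> with
  probability at most \<open>2 \<surd>\<delta>\<close>; this also covers bounded \<open>m\<close>.\<close>

section \<open>The law of the trajectory\<close>

text \<open>A pushforward keeps the total mass, so one pushforward of mass 1 suffices. The
  projection to the empty set of coordinates is a finite-dimensional marginal of the limit, hence a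
  probability measure.\<close>

lemma prob_space_process: "prob_space (semi_random_process n S)"
proof (rule prob_space_distrD)
  let ?M = "\<lambda>_ :: nat. count_space (UNIV :: (nat \<times> nat) set)"
  show "prob_space (distr (semi_random_process n S) (PiM {} ?M) (\<lambda>\<omega>. restrict \<omega> {}))"
    using semi_random.distr_lim[of "{}" n S] semi_random.PF.prob_space_P[of "{}" n S]
    by (simp add: semi_random_process_def)
  show "(\<lambda>\<omega>. restrict \<omega> {}) \<in> measurable (semi_random_process n S) (PiM {} ?M)"
    by (rule measurable_restrict) simp
qed

lemma space_process [simp]: "space (semi_random_process n S) = UNIV"
  by (simp add: semi_random_process_def space_PiM)

lemma sets_process [measurable_cong]:
  "sets (semi_random_process n S) = sets (PiM UNIV (\<lambda>_. count_space UNIV))"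
  by (simp add: semi_random_process_def)

lemma measurable_round:
  "(\<lambda>\<omega>. \<omega> t) \<in> measurable (semi_random_process n S) (count_space UNIV)"
  unfolding measurable_cong_sets[OF sets_process refl]
  by (rule measurable_component_singleton) (rule UNIV_I)

text \<open>There are only countably many histories, so preimages of single histories suffice. Each
  is a finite intersection of events about one round.\<close>

lemma measurable_history [measurable]:
  "(\<lambda>\<omega>. map \<omega> [0..<t]) \<in> measurable (semi_random_process n S) (count_space UNIV)"
  unfolding measurable_count_space_eq_countable[OF countableI_type]
proof (intro conjI ballI)
  fix l :: history
  have "Measurable.pred (semi_random_process n S) (\<lambda>\<omega>. \<omega> i = l ! i)" for i
    by (rule measurable_compose[OF measurable_round]) simp
  note round_eq = this[unfolded pred_def]
  have "map \<omega> [0..<t] = l \<longleftrightarrow> length l = t \<and> (\<forall>i\<in>{..<t}. \<omega> i = l ! i)" for \<omega>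
    by (auto intro: nth_equalityI)
  then have "(\<lambda>\<omega>. map \<omega> [0..<t]) -` {l} \<inter> space (semi_random_process n S) =
      {\<omega> \<in> space (semi_random_process n S). length l = t \<and> (\<forall>i\<in>{..<t}. \<omega> i = l ! i)}"
    by blast
  also have "\<dots> \<in> sets (semi_random_process n S)"
    by (intro sets.sets_Collect_conj sets.sets_Collect_const sets.sets_Collect_finite_All round_eq) auto
  finally show "(\<lambda>\<omega>. map \<omega> [0..<t]) -` {l} \<inter> space (semi_random_process n S)
      \<in> sets (semi_random_process n S)" .
qed simp

lemma pred_history [measurable]:
  "Measurable.pred (semi_random_process n S) (\<lambda>\<omega>. Q (map \<omega> [0..<t]))"
  by measurable

text \<open>Only the first \<open>t + 1\<close> rounds matter: in the history of that length,
  \<open>last\<close> is round \<open>t\<close> and \<open>butlast\<close> is the history before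
  it.\<close>

lemma pred_round [measurable]:
  "Measurable.pred (semi_random_process n S) (\<lambda>\<omega>. \<omega> t \<in> A (map \<omega> [0..<t]))"
proof -
  have "(\<lambda>\<omega>. \<omega> t \<in> A (map \<omega> [0..<t])) =
      (\<lambda>\<omega>. (\<lambda>l. last l \<in> A (butlast l)) (map \<omega> [0..<Suc t]))"
    by (simp add: fun_eq_iff)
  then show ?thesis
    using pred_history[where Q="\<lambda>l. last l \<in> A (butlast l)" and t="Suc t"] by (simp only:)
qed

text \<open>Passage from conditional to unconditional probabilities. The event is a cylinder over
  the first \<open>t + 1\<close> rounds; its mass is the average, over the law of the first
  \<open>t\<close> rounds, of the conditional probability of \<open>A h\<close>. An average of
  values at most \<open>c\<close> is at most \<open>c\<close>.\<close>

lemma emeasure_round_le: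
  assumes "\<And>h. length h = t \<Longrightarrow> emeasure (next_round n S h) (A h) \<le> c"
  shows "emeasure (semi_random_process n S) {\<omega>. \<omega> t \<in> A (map \<omega> [0..<t])} \<le> c"
proof -
  let ?M = "\<lambda>_ :: nat. count_space (UNIV :: (nat \<times> nat) set)"
  let ?J = "{0..<Suc t}"
  let ?C = "semi_random.C n S 0"
  define X where "X = {\<omega> \<in> space (PiM ?J ?M). \<omega> t \<in> A (map \<omega> [0..<t])}"
  \<comment> \<open>A finite product of countable discrete spaces is discrete, so every set of
    finite trajectories is measurable.\<close>
  have X: "X \<in> sets (PiM ?J ?M)"
    by (subst count_space_PiM_finite) (auto simp: X_def space_PiM)
  have "map (restrict \<omega> ?J) [0..<t] = map \<omega> [0..<t]" for \<omega> :: "nat \<Rightarrow> nat \<times> nat"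
    by simp
  then have "prod_emb UNIV ?M ?J X = {\<omega>. \<omega> t \<in> A (map \<omega> [0..<t])}"
    by (auto simp: X_def prod_emb_def space_PiM simp del: map_eq_conv)
  then have "emeasure (semi_random_process n S) {\<omega>. \<omega> t \<in> A (map \<omega> [0..<t])} =
      emeasure (semi_random.CI n S ?J) X"
    unfolding semi_random_process_def using semi_random.lim[OF _ X, of n S] by simp
  also have "\<dots> = emeasure (?C (Suc t) (\<lambda>_. undefined)) X"
  proof -
    have "prod_emb ?J ?M ?J X = X"
      using sets.sets_into_space[OF X] by (intro prod_emb_id) (simp add: space_PiM)
    then show ?thesis
      using semi_random.emeasure_CI[OF order_refl X, of n S] by simp
  qed
  also have "\<dots> = (\<integral>\<^sup>+ \<omega>. emeasure (semi_random.eP n S t \<omega>) X \<partial>?C t (\<lambda>_. undefined))"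
  proof -
    have "space (PiM {0..<t} ?M) \<noteq> {}"
      by (simp add: space_PiM PiE_eq_empty_iff)
    moreover have sets_C: "sets (?C t (\<lambda>_. undefined)) = sets (PiM {0..<t} ?M)"
      using semi_random.sets_C[of "\<lambda>_. undefined" 0 n S t] by simp
    ultimately show ?thesis
      using X semi_random.measurable_eP[of n S t] sets_eq_imp_space_eq[OF sets_C]
      by (simp, subst emeasure_bind[where N="PiM ?J ?M"])
        (auto simp: measurable_cong_sets[OF sets_C refl])
  qed
  also have "\<dots> \<le> (\<integral>\<^sup>+ \<omega>. c \<partial>?C t (\<lambda>_. undefined))"
  proof (rule nn_integral_mono)
    fix \<omega> assume "\<omega> \<in> space (?C t (\<lambda>_. undefined))"
    then have \<omega>: "\<omega> \<in> space (PiM {0..<t} ?M)"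
      using semi_random.space_C[of "\<lambda>_. undefined" 0 n S t] by simp
    \<comment> \<open>Setting coordinate \<open>t\<close> leaves the earlier history intact, so the
      section of \<open>X\<close> over \<omega> is exactly \<open>A\<close> of that history.\<close>
    have "map (fun_upd \<omega> t x) [0..<t] = map \<omega> [0..<t]" for x
      by simp
    then have "fun_upd \<omega> t -` X = A (map \<omega> [0..<t])"
      using \<omega> by (auto simp: X_def space_PiM PiE_iff extensional_def simp del: map_eq_conv map_fun_upd)
    then have "emeasure (semi_random.eP n S t \<omega>) X
        = emeasure (next_round n S (map \<omega> [0..<t])) (A (map \<omega> [0..<t]))"
      using semi_random.emeasure_eP[OF \<omega> X, of n S] by (simp add: round_kernel_def)
    then show "emeasure (semi_random.eP n S t \<omega>) X \<le> c"
      using assms by simp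
  qed
  also have "\<dots> \<le> c"
    using prob_space.emeasure_space_1[OF semi_random.prob_space_C[of "\<lambda>_. undefined" 0 n S t]]
    by simp
  finally show ?thesis .
qed

section \<open>Graphs and numbers of rounds\<close>

text \<open>The graph is a function of the history of length \<open>t\<close>, and all predicates of
  that history are measurable.\<close>

lemma pred_graph_after [measurable]:
  "Measurable.pred (semi_random_process n S) (\<lambda>\<omega>. graph_after k t \<omega> \<in> P)"
proof -
  have "graph_after k t \<omega> = graph_after k t (\<lambda>s. map \<omega> [0..<t] ! s)" for \<omega>
  proof -
    have "(map \<omega> [0..<t]) ! s = \<omega> s" if "s < t" for s
      using that by simp
    then show ?thesis
      unfolding graph_after_def by (metis (no_types, lifting))
  qed
  then have "(\<lambda>\<omega>. graph_after k t \<omega> \<in> P) =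
      (\<lambda>\<omega>. (\<lambda>l. graph_after k t (\<lambda>s. l ! s) \<in> P) (map \<omega> [0..<t]))"
    by metis
  then show ?thesis
    using pred_history[where Q="\<lambda>l. graph_after k t (\<lambda>s. l ! s) \<in> P" and t=t] by (simp only:)
qed

text \<open>Turns a bound on an infimum in \<open>enat\<close> into a countable union of events
  about single graphs. A finite bound rules out the infimum of the empty set, and by well-ordering
  any other infimum is attained.\<close>

lemma rounds_needed_le_iff:
  "ereal_of_enat (rounds_needed n P \<omega>) \<le> ereal x \<longleftrightarrow>
     (\<exists>t. graph_after n t \<omega> \<in> P \<and> real t \<le> x)"
proof
  assume *: "ereal_of_enat (rounds_needed n P \<omega>) \<le> ereal x"
  then have "rounds_needed n P \<omega> \<noteq> \<infinity>"
    by (metis PInfty_neq_ereal(1) ereal_infty_less_eq(1) ereal_of_enat_simps(2))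
  then have "enat ` {t. graph_after n t \<omega> \<in> P} \<noteq> {}"
    by (auto simp: rounds_needed_def Inf_enat_def simp del: not_infinity_eq split: if_splits)
  then have "rounds_needed n P \<omega> \<in> enat ` {t. graph_after n t \<omega> \<in> P}"
    unfolding rounds_needed_def by (auto intro: wellorder_InfI)
  then obtain t where "rounds_needed n P \<omega> = enat t" "graph_after n t \<omega> \<in> P"
    by auto
  with * show "\<exists>t. graph_after n t \<omega> \<in> P \<and> real t \<le> x"
    by auto
next
  assume "\<exists>t. graph_after n t \<omega> \<in> P \<and> real t \<le> x"
  then obtain t where t: "graph_after n t \<omega> \<in> P" "real t \<le> x"
    by auto
  then have "rounds_needed n P \<omega> \<le> enat t"
    unfolding rounds_needed_def by (auto intro: Inf_lower)
  then have "ereal_of_enat (rounds_needed n P \<omega>) \<le> ereal_of_enat (enat t)"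
    by (simp only: ereal_of_enat_le_iff)
  also have "\<dots> \<le> ereal x"
    using t by simp
  finally show "ereal_of_enat (rounds_needed n P \<omega>) \<le> ereal x" .
qed

lemma rounds_needed_ge: "enat m \<le> rounds_needed n (has_bipartite_subgraph n m) \<omega>"
  unfolding rounds_needed_def
proof (rule Inf_greatest, safe)
  fix t assume "graph_after n t \<omega> \<in> has_bipartite_subgraph n m"
  then obtain H where H: "subgraph H (graph_after n t \<omega>)" "card (snd H) = m"
    unfolding has_bipartite_subgraph_def by blast
  have *: "snd (graph_after n t \<omega>) \<subseteq> (\<lambda>s. {fst (\<omega> s), snd (\<omega> s)}) ` {..<t}"
    by (auto simp: graph_after_def)
  have "m \<le> card ((\<lambda>s. {fst (\<omega> s), snd (\<omega> s)}) ` {..<t})"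
    unfolding H(2)[symmetric] using H(1) * by (intro card_mono) (auto simp: subgraph_def)
  also have "\<dots> \<le> t"
    using card_image_le[of "{..<t}"] by simp
  finally show "enat m \<le> enat t"
    by simp
qed

text \<open>Here \<open>I\<close> is a set of useful rounds, and the two colour classes are the
  vertices up to \<open>k\<close> and those above \<open>k\<close>. Discarding surplus rounds gives
  exactly \<open>m\<close> edges.\<close>

lemma has_bipartite_subgraphI:
  assumes range: "\<And>s. s < t \<Longrightarrow> \<omega> s \<in> {1..n} \<times> {1..n}"
    and good: "I \<subseteq> {..<t}" "m \<le> card I" "inj_on \<omega> I"
    and cut: "\<And>s. s \<in> I \<Longrightarrow> k < fst (\<omega> s) \<and> snd (\<omega> s) \<le> k"
  shows "graph_after n t \<omega> \<in> has_bipartite_subgraph n m"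
proof -
  let ?e = "\<lambda>s. {fst (\<omega> s), snd (\<omega> s)}"
  obtain J where J: "J \<subseteq> I" "card J = m"
    using good(2) obtain_subset_with_card_n by metis
  have "inj_on ?e J"
  proof (rule inj_onI)
    fix s s' assume s: "s \<in> J" "s' \<in> J" and eq: "?e s = ?e s'"
    \<comment> \<open>The threshold \<open>k\<close> orients every edge, so equal edges cannot come
      from swapped pairs.\<close>
    have "fst (\<omega> s) = fst (\<omega> s') \<and> snd (\<omega> s) = snd (\<omega> s')"
      using eq cut[of s] cut[of s'] s J(1) by (force simp: doubleton_eq_iff)
    then show "s = s'"
      using good(3) s J by (auto simp: inj_on_def prod_eq_iff)
  qed
  then have card: "card (?e ` J) = m"
    using J card_image by metis
  let ?H = "({1..n}, ?e ` J) :: graph"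
  have edge: "fst (\<omega> s) \<in> {1..n}" "snd (\<omega> s) \<in> {1..n}" if "s < t" for s
    using range[OF that] by (auto simp: mem_Times_iff)
  have J_edge: "s < t" "k < fst (\<omega> s)" "snd (\<omega> s) \<le> k" if "s \<in> J" for s
    using that J good(1) cut[of s] by auto
  have G: "simple_graph (graph_after n t \<omega>)"
    unfolding simple_graph_def graph_after_def using edge by fastforce
  have H: "simple_graph ?H"
    unfolding simple_graph_def
  proof
    fix e assume "e \<in> snd ?H"
    then obtain s where s: "s \<in> J" "e = ?e s"
      by auto
    then show "\<exists>x\<in>fst ?H. \<exists>y\<in>fst ?H. x \<noteq> y \<and> e = {x, y}"
      using J_edge[OF s(1)] edge[of s]
      by (intro bexI[of _ "fst (\<omega> s)"] bexI[of _ "snd (\<omega> s)"]) auto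
  qed
  have "\<forall>e\<in>snd ?H. \<exists>a\<in>{1..n} \<inter> {k<..}. \<exists>b\<in>{1..n} \<inter> {..k}. e = {a, b}"
  proof
    fix e assume "e \<in> snd ?H"
    then obtain s where s: "s \<in> J" "e = ?e s"
      by auto
    then show "\<exists>a\<in>{1..n} \<inter> {k<..}. \<exists>b\<in>{1..n} \<inter> {..k}. e = {a, b}"
      using J_edge[OF s(1)] edge[of s]
      by (intro bexI[of _ "fst (\<omega> s)"] bexI[of _ "snd (\<omega> s)"]) auto
  qed
  moreover have "({1..n} \<inter> {k<..}) \<union> ({1..n} \<inter> {..k}) = fst ?H"
    "({1..n} \<inter> {k<..}) \<inter> ({1..n} \<inter> {..k}) = {}"
    by auto
  ultimately have "bipartite ?H"
    unfolding bipartite_def using H by blast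
  moreover have "subgraph ?H (graph_after n t \<omega>)"
    unfolding subgraph_def using H G J_edge
    by (fastforce simp: graph_after_def)
  moreover have "fst (graph_after n t \<omega>) = {1..n}"
    by (simp add: graph_after_def)
  ultimately show ?thesis
    unfolding has_bipartite_subgraph_def using G card by (auto intro!: exI[of _ ?H])
qed

section \<open>Cycling through the hubs\<close>

text \<open>The \<open>min n\<close> keeps the choice in \<open>[n]\<close> for the finitely many \<open>n\<close> that are smaller than the
  number \<open>k\<close> of hubs.\<close>

definition hub_strategy :: "nat \<Rightarrow> nat \<Rightarrow> strategy" where
  "hub_strategy k n h u = return_pmf (min n (Suc (length h mod k)))"

lemma hub_strategy_pre_positional: "hub_strategy k n \<in> pre_positional n"
  by (auto simp: pre_positional_def post_positional_def hub_strategy_def fun_eq_iff)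

lemma hub_strategy_deterministic: "deterministic (hub_strategy k n)"
  by (auto simp: deterministic_def hub_strategy_def)

lemma emeasure_next_round_hub:
  assumes "0 < n"
  shows "emeasure (next_round n (hub_strategy k n) h) A =
    ennreal (real (card {u \<in> {1..n}. (u, min n (Suc (length h mod k))) \<in> A}) / real n)"
proof -
  let ?v = "min n (Suc (length h mod k))"
  have "next_round n (hub_strategy k n) h = map_pmf (\<lambda>u. (u, ?v)) (pmf_of_set {1..n})"
    by (simp add: next_round_def hub_strategy_def map_pmf_def bind_return_pmf)
  then show ?thesis
    using assms
    by (simp add: emeasure_pmf_of_set vimage_def Int_def measure_pmf.emeasure_eq_measure
        measure_pmf_of_set)
qed

text \<open>Under the hub strategy with \<open>k \<le> n\<close>, rounds with equal index mod
  \<open>k\<close> use the same hub. Comparing indices instead of chosen vertices makes membership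
  depend on the offered vertex and the history alone.\<close>

definition wasted :: "nat \<Rightarrow> history \<Rightarrow> (nat \<times> nat) set" where
  "wasted k h = {(u, v). u \<le> k \<or> (\<exists>s<length h. s mod k = length h mod k \<and> fst (h ! s) = u)}"

text \<open>Inside a residue class a number is determined by its quotient, and \<open>s < t\<close>
  in the same class forces a smaller quotient.\<close>

lemma card_residue_le:
  fixes t k :: nat
  shows "card {s. s < t \<and> s mod k = t mod k} \<le> t div k"
proof -
  have "inj_on (\<lambda>s. s div k) {s. s < t \<and> s mod k = t mod k}"
    by (rule inj_onI) (metis (mono_tags, lifting) div_mult_mod_eq mem_Collect_eq)
  moreover have "s div k < t div k" if "s < t" "s mod k = t mod k" for s
    using that by (metis div_le_mono div_mult_mod_eq le_neq_implies_less less_imp_le_nat nat_neq_iff)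
  ultimately have "card {s. s < t \<and> s mod k = t mod k} \<le> card {..<t div k}"
    by (intro card_inj_on_le[where f="\<lambda>s. s div k"]) auto
  then show ?thesis
    by simp
qed

lemma emeasure_wasted_le:
  assumes "0 < n"
  shows "emeasure (semi_random_process n (hub_strategy k n)) {\<omega>. \<omega> t \<in> wasted k (map \<omega> [0..<t])}
    \<le> ennreal ((real k + real t / real k) / real n)"
proof (rule emeasure_round_le)
  fix h :: history assume h: "length h = t"
  let ?v = "min n (Suc (length h mod k))"
  let ?R = "{s. s < t \<and> s mod k = t mod k}"
  \<comment> \<open>The bad offers are the hubs and the vertices already offered for the current
    hub.\<close>
  have "card {u \<in> {1..n}. (u, ?v) \<in> wasted k h} \<le> card ({1..k} \<union> (\<lambda>s. fst (h ! s)) ` ?R)"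
    by (rule card_mono) (auto simp: wasted_def h)
  also have "\<dots> \<le> k + card ((\<lambda>s. fst (h ! s)) ` ?R)"
    using card_Un_le[of "{1..k}"] by simp
  also have "\<dots> \<le> k + t div k"
    using card_image_le[of ?R "\<lambda>s. fst (h ! s)"] card_residue_le[of t k] by simp
  finally have "real (card {u \<in> {1..n}. (u, ?v) \<in> wasted k h}) \<le> k + real (t div k)"
    by linarith
  also have "\<dots> \<le> k + t / k"
    by (simp add: of_nat_div_le_of_nat)
  finally show "emeasure (next_round n (hub_strategy k n) h) (wasted k h) \<le> ennreal ((real k + real t / real k) / real n)"
    using assms by (simp add: emeasure_next_round_hub divide_right_mono ennreal_leI)
qed

text \<open>The law of the process pins down the played vertices only up to a null set: each
  violation has conditional probability 0, and there are countably many rounds. As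
  \<open>k \<le> n\<close>, the truncation by \<open>min n\<close> has no effect.\<close>

lemma AE_hub_round:
  assumes "0 < k" "k \<le> n"
  shows "AE \<omega> in semi_random_process n (hub_strategy k n).
    \<forall>t. \<omega> t \<in> {1..n} \<times> {1..n} \<and> snd (\<omega> t) = Suc (t mod k)"
proof (subst AE_all_countable, rule allI)
  fix t
  let ?M = "semi_random_process n (hub_strategy k n)"
  have "emeasure ?M {\<omega>. \<omega> t \<in> (\<lambda>h. - ({1..n} \<times> {Suc (t mod k)})) (map \<omega> [0..<t])} \<le> 0"
  proof (rule emeasure_round_le)
    fix h :: history assume "length h = t"
    moreover have "Suc (t mod k) \<le> n"
      using assms mod_less_divisor[of k t] by linarith
    ultimately show "emeasure (next_round n (hub_strategy k n) h) (- ({1..n} \<times> {Suc (t mod k)})) \<le> 0"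
      using assms by (simp add: emeasure_next_round_hub)
  qed
  moreover have "{\<omega>. \<omega> t \<in> (\<lambda>h. - ({1..n} \<times> {Suc (t mod k)})) (map \<omega> [0..<t])} \<in> sets ?M"
    using pred_round[where A="\<lambda>h. - ({1..n} \<times> {Suc (t mod k)})" and t=t]
    by (simp add: pred_def)
  ultimately have "AE \<omega> in ?M. \<omega> t \<notin> - ({1..n} \<times> {Suc (t mod k)})"
    by (subst AE_iff_measurable[where N="{\<omega>. \<omega> t \<in> - ({1..n} \<times> {Suc (t mod k)})}"]) auto
  then show "AE \<omega> in ?M. \<omega> t \<in> {1..n} \<times> {1..n} \<and> snd (\<omega> t) = Suc (t mod k)"
  proof (rule AE_mp, intro AE_I2 impI)
    fix \<omega> assume "\<omega> t \<notin> - ({1..n} \<times> {Suc (t mod k)})"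
    moreover have "Suc (t mod k) \<le> n"
      using assms mod_less_divisor[of k t] by linarith
    ultimately show "\<omega> t \<in> {1..n} \<times> {1..n} \<and> snd (\<omega> t) = Suc (t mod k)"
      by (auto simp: mem_Times_iff)
  qed
qed

lemma few_wasted_imp_bipartite:
  assumes k: "0 < k"
    and rounds: "\<And>t. \<omega> t \<in> {1..n} \<times> {1..n} \<and> snd (\<omega> t) = Suc (t mod k)"
    and few: "card {t. t < N \<and> \<omega> t \<in> wasted k (map \<omega> [0..<t])} + m \<le> N"
  shows "graph_after n N \<omega> \<in> has_bipartite_subgraph n m"
proof (rule has_bipartite_subgraphI)
  let ?W = "{t. t < N \<and> \<omega> t \<in> wasted k (map \<omega> [0..<t])}"
  have "card ({..<N} - ?W) = N - card ?W"
    by (subst card_Diff_subset) auto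
  then show "m \<le> card ({..<N} - ?W)"
    using few by linarith
  \<comment> \<open>Only the later round has to be useful: a repeated pair repeats its hub, hence
    its residue, so the offered vertex would make round \<open>t\<close> wasted.\<close>
  have "\<omega> s \<noteq> \<omega> t" if "s < t" "t \<in> {..<N} - ?W" for s t
  proof
    assume eq: "\<omega> s = \<omega> t"
    then have "s mod k = t mod k"
      using rounds[of s] rounds[of t] by simp
    then have "\<omega> t \<in> wasted k (map \<omega> [0..<t])"
      using that eq unfolding wasted_def by (auto simp: case_prod_unfold intro!: exI[of _ s])
    then show False
      using that by auto
  qed
  then show "inj_on \<omega> ({..<N} - ?W)"
    by (intro linorder_inj_onI) (auto simp del: Diff_iff)
  fix s
  show "\<omega> s \<in> {1..n} \<times> {1..n}"
    using rounds by blast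
  assume "s \<in> {..<N} - ?W"
  then show "k < fst (\<omega> s) \<and> snd (\<omega> s) \<le> k"
    using k rounds[of s] by (auto simp: wasted_def case_prod_unfold Suc_le_eq)
qed auto

text \<open>Linearity of expectation bounds the mean number of wasted rounds without any
  independence between rounds; Markov's inequality then bounds the probability of failure.\<close>

lemma prob_hub_strategy_ge:
  assumes k: "0 < k" "k \<le> n" and "m \<le> N"
  shows "measure (semi_random_process n (hub_strategy k n))
      {\<omega>. graph_after n N \<omega> \<in> has_bipartite_subgraph n m}
    \<ge> 1 - N * ((k + N / k) / n) / (real N + 1 - real m)"
proof -
  let ?M = "semi_random_process n (hub_strategy k n)"
  interpret prob_space ?M
    by (rule prob_space_process)
  define E where "E t = {\<omega>. \<omega> t \<in> wasted k (map \<omega> [0..<t])}" for t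
  define W where "W \<omega> = (\<Sum>t<N. indicator (E t) \<omega> :: real)" for \<omega>
  define d where "d = (k + N / k) / n"
  \<comment> \<open>Failure needs more than \<open>N - m\<close> wasted rounds, and the count is an
    integer, so at least \<open>N + 1 - m\<close>. This threshold is positive even if
    \<open>N = m\<close>.\<close>
  define c where "c = real N + 1 - real m"
  have c: "0 < c"
    using \<open>m \<le> N\<close> by (simp add: c_def)
  have E [measurable]: "E t \<in> events" for t
    using pred_round[where A="wasted k" and t=t] by (simp add: pred_def E_def)
  have "prob (E t) \<le> d" if "t < N" for t
  proof -
    have "emeasure ?M (E t) \<le> ennreal ((real k + real t / real k) / real n)"
      unfolding E_def using k by (intro emeasure_wasted_le) auto
    then have "prob (E t) \<le> (k + t / k) / n"
      by (simp add: emeasure_eq_measure)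
    also have "\<dots> \<le> d"
      unfolding d_def using that k by (intro divide_right_mono add_left_mono) auto
    finally show ?thesis .
  qed
  then have "(\<Sum>t<N. prob (E t)) \<le> N * d"
    using sum_bounded_above[of "{..<N}" "\<lambda>t. prob (E t)" d] by simp
  moreover have "expectation W = (\<Sum>t<N. prob (E t))"
    unfolding W_def by (subst Bochner_Integration.integral_sum) (auto simp: emeasure_eq_measure)
  ultimately have exp: "expectation W \<le> N * d"
    by simp
  have W_int: "integrable ?M W"
    unfolding W_def[abs_def]
    by (rule Bochner_Integration.integrable_sum[where f="\<lambda>t. indicat_real (E t)"])
      (simp add: emeasure_eq_measure)
  have W_nonneg: "0 \<le> W \<omega>" for \<omega>
    unfolding W_def by (intro sum_nonneg) simp
  have "prob {\<omega>\<in>space ?M. c \<le> W \<omega>} \<le> expectation W / c"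
    by (rule integral_Markov_inequality_measure[where A="{}"])
      (use W_int c W_nonneg in auto)
  also have "\<dots> \<le> N * d / c"
    using exp c by (intro divide_right_mono) auto
  finally have markov: "prob {\<omega>\<in>space ?M. c \<le> W \<omega>} \<le> N * d / c" .
  have W_event: "{\<omega> \<in> space ?M. c \<le> W \<omega>} \<in> events"
    using W_int by (intro borel_measurable_le borel_measurable_const) auto
  have sets: "{\<omega>. graph_after n N \<omega> \<in> has_bipartite_subgraph n m} \<in> events"
    using pred_graph_after[where k=n and t=N and P="has_bipartite_subgraph n m"]
    by (simp add: pred_def)
  have "1 - prob {\<omega>\<in>space ?M. c \<le> W \<omega>} = prob {\<omega>\<in>space ?M. \<not> c \<le> W \<omega>}"
    by (rule prob_neg[OF W_event, symmetric])
  also have "\<dots> \<le> prob {\<omega>. graph_after n N \<omega> \<in> has_bipartite_subgraph n m}"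
  proof (rule finite_measure_mono_AE[OF _ sets])
    show "AE \<omega> in ?M. \<omega> \<in> {\<omega> \<in> space ?M. \<not> c \<le> W \<omega>} \<longrightarrow>
      \<omega> \<in> {\<omega>. graph_after n N \<omega> \<in> has_bipartite_subgraph n m}"
      using AE_hub_round[OF k]
    proof (rule AE_mp, intro AE_I2 impI, clarify)
      fix \<omega> assume *: "\<forall>t. \<omega> t \<in> {1..n} \<times> {1..n} \<and> snd (\<omega> t) = Suc (t mod k)"
        and "\<not> c \<le> W \<omega>"
      have "W \<omega> = card {t. t < N \<and> \<omega> t \<in> wasted k (map \<omega> [0..<t])}"
        by (simp add: W_def E_def indicator_def sum.If_cases Int_def lessThan_def)
      then have "card {t. t < N \<and> \<omega> t \<in> wasted k (map \<omega> [0..<t])} + m \<le> N"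
        using \<open>\<not> c \<le> W \<omega>\<close> by (simp add: c_def)
      then show "graph_after n N \<omega> \<in> has_bipartite_subgraph n m"
        using * k by (intro few_wasted_imp_bipartite[of k]) auto
    qed
  qed
  finally show ?thesis
    using markov unfolding d_def c_def by linarith
qed

section \<open>Asymptotics\<close>

text \<open>The numerator is at most \<open>2 * m * \<delta>\<close> and the denominator at least
  \<open>sqrt \<delta> * m\<close>. A surplus of a fraction \<open>sqrt \<delta>\<close> of the
  rounds thus leaves a quotient of the same order \<open>sqrt \<delta>\<close>.\<close>

lemma hub_failure_bound:
  fixes m k n N :: nat
  defines "\<delta> \<equiv> (3 * sqrt m + 1) / n"
  assumes k: "k = Suc (nat \<lfloor>sqrt m\<rfloor>)" and N: "N = nat \<lfloor>(1 + sqrt \<delta>) * m\<rfloor>"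
    and "\<delta> \<le> 1" "0 < n"
  shows "N * ((k + N / k) / n) / (real N + 1 - real m) \<le> 2 * sqrt \<delta>"
proof (cases "m = 0")
  case True
  then show ?thesis
    using N by (simp add: \<delta>_def)
next
  case False
  have \<delta>: "0 < \<delta>"
    using \<open>0 < n\<close> by (simp add: \<delta>_def add_nonneg_pos)
  have \<epsilon>: "0 < sqrt \<delta>" "sqrt \<delta> \<le> 1"
    using \<delta> \<open>\<delta> \<le> 1\<close> by auto
  have k': "sqrt m \<le> k" "k \<le> sqrt m + 1"
    unfolding k by (auto simp: of_nat_nat) linarith+
  have N': "N \<le> (1 + sqrt \<delta>) * m" "(1 + sqrt \<delta>) * m < real N + 1"
    unfolding N using \<epsilon> by (auto simp: of_nat_nat) 
  have "N / k \<le> 2 * sqrt m"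
  proof -
    have "N \<le> 2 * real m"
      using N'(1) \<epsilon>(2) mult_right_mono[of "1 + sqrt \<delta>" 2 "real m"] by linarith
    also have "\<dots> = 2 * sqrt m * sqrt m"
      by simp
    also have "\<dots> \<le> 2 * sqrt m * k"
      using k'(1) by (intro mult_left_mono) auto
    finally show ?thesis
      by (simp add: k pos_divide_le_eq del: of_nat_Suc)
  qed
  \<comment> \<open>The bounds \<open>sqrt m + 1\<close> for \<open>k\<close> and
    \<open>2 * sqrt m\<close> for \<open>N / k\<close> add up to the numerator of \<delta>.\<close>
  then have "(k + N / k) / n \<le> \<delta>"
    unfolding \<delta>_def using k'(2) by (intro divide_right_mono) auto
  then have "N * ((k + N / k) / n) \<le> ((1 + sqrt \<delta>) * m) * \<delta>"
    using N'(1) \<epsilon> by (intro mult_mono) auto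
  also have "\<dots> \<le> (2 * m) * \<delta>"
    using \<epsilon> \<delta> by (intro mult_right_mono) (auto intro: mult_right_mono)
  finally have num: "N * ((k + N / k) / n) \<le> 2 * m * \<delta>" .
  \<comment> \<open>The \<open>+ 1\<close> from the Markov threshold absorbs the rounding down in
    \<open>N\<close>, so \<open>sqrt \<delta> * m\<close> may be smaller than 1.\<close>
  have den: "sqrt \<delta> * m \<le> real N + 1 - real m"
    using N'(2) by (simp add: algebra_simps)
  have "N * ((k + N / k) / n) / (real N + 1 - real m) \<le> 2 * m * \<delta> / (sqrt \<delta> * m)"
    using num den \<epsilon> \<delta> False by (intro frac_le) auto
  also have "\<dots> = 2 * sqrt \<delta>"
    using False \<delta> by (simp add: field_simps)
  finally show ?thesis .
qed

theorem theorem1p5: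
  fixes m :: "nat \<Rightarrow> nat"
  assumes "(\<lambda>n. real (m n)) \<in> o(\<lambda>n. real n ^ 2)"
  shows "\<forall>strategies \<in> {pre_positional, post_positional}.
    (\<forall>S. (\<forall>n. S n \<in> strategies n) \<longrightarrow>
       aas S (\<lambda>n \<omega>. enat (m n) \<le> rounds_needed n (has_bipartite_subgraph n (m n)) \<omega>)) \<and>
    (\<exists>S. (\<forall>n. S n \<in> strategies n \<and> deterministic (S n)) \<and>
       (\<exists>\<epsilon> :: nat \<Rightarrow> real. \<epsilon> \<longlonglongrightarrow> 0 \<and>
          aas S (\<lambda>n \<omega>. ereal_of_enat (rounds_needed n (has_bipartite_subgraph n (m n)) \<omega>)
                         \<le> ereal ((1 + \<epsilon> n) * real (m n)))))"
proof -
  \<comment> \<open>The bound holds on every trajectory, so the event is the whole space and has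
    probability exactly 1 for each \<open>n\<close>.\<close>
  have lower: "aas S (\<lambda>n \<omega>. enat (m n) \<le> rounds_needed n (has_bipartite_subgraph n (m n)) \<omega>)" for S
    unfolding aas_def using rounds_needed_ge prob_space.prob_space[OF prob_space_process] by simp

  define \<delta> where "\<delta> n = (3 * sqrt (m n) + 1) / n" for n
  define \<epsilon> where "\<epsilon> n = sqrt (\<delta> n)" for n
  define k where "k n = Suc (nat \<lfloor>sqrt (m n)\<rfloor>)" for n
  define S where "S n = hub_strategy (k n) n" for n

  have "(\<lambda>n. real (m n) / real n ^ 2) \<longlonglongrightarrow> 0"
    using smalloD_tendsto[OF assms] .
  then have "(\<lambda>n. sqrt (real (m n) / real n ^ 2)) \<longlonglongrightarrow> sqrt 0"
    by (rule tendsto_real_sqrt)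
  then have "(\<lambda>n. 3 * (sqrt (m n) / n) + 1 / n) \<longlonglongrightarrow> 3 * 0 + 0"
    by (intro tendsto_add tendsto_mult tendsto_const lim_1_over_n) (simp add: real_sqrt_divide)
  then have \<delta>: "\<delta> \<longlonglongrightarrow> 0"
    by (simp add: \<delta>_def[abs_def] add_divide_distrib)
  then have \<epsilon>: "\<epsilon> \<longlonglongrightarrow> 0"
    unfolding \<epsilon>_def[abs_def] using tendsto_real_sqrt[OF \<delta>] by simp

  let ?good = "\<lambda>n. {\<omega> \<in> space (semi_random_process n (S n)).
    ereal_of_enat (rounds_needed n (has_bipartite_subgraph n (m n)) \<omega>)
      \<le> ereal ((1 + \<epsilon> n) * real (m n))}"
  have "\<forall>\<^sub>F n in sequentially. 1 - 2 * \<epsilon> n \<le> measure (semi_random_process n (S n)) (?good n)"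
  proof -
    have "\<forall>\<^sub>F n in sequentially. \<delta> n < 1"
      using \<delta> by (rule order_tendstoD) simp
    then show ?thesis
      \<comment> \<open>Division by zero makes \<open>\<delta> 0 = 0\<close>, so
        \<open>\<delta> n < 1\<close> alone does not exclude \<open>n = 0\<close>.\<close>
      using eventually_gt_at_top[of 0]
    proof eventually_elim
      case (elim n)
      let ?M = "semi_random_process n (S n)"
      interpret prob_space ?M
        by (rule prob_space_process)
      define N where "N = nat \<lfloor>(1 + \<epsilon> n) * m n\<rfloor>"
      have \<epsilon>0: "0 \<le> \<epsilon> n"
        by (simp add: \<epsilon>_def \<delta>_def)
      have "m n \<le> (1 + \<epsilon> n) * m n"
        using \<epsilon>0 by (simp add: algebra_simps)
      then have "m n \<le> N"
        unfolding N_def by (simp add: le_nat_floor)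
      \<comment> \<open>The condition \<open>\<delta> n < 1\<close> also makes the hubs fit into the
        vertex set.\<close>
      have "3 * sqrt (m n) + 1 < n"
        using elim by (simp add: \<delta>_def)
      then have "sqrt (m n) < n"
        using real_sqrt_ge_zero[of "real (m n)"] by linarith
      then have "k n \<le> n"
        unfolding k_def by (simp add: Suc_le_eq nat_less_iff floor_less_iff)
      have "1 - 2 * \<epsilon> n \<le> 1 - N * ((k n + N / k n) / n) / (real N + 1 - real (m n))"
        using hub_failure_bound[of "k n" "m n" N n] elim
        by (simp add: k_def N_def \<epsilon>_def \<delta>_def)
      also have "\<dots> \<le> prob {\<omega>. graph_after n N \<omega> \<in> has_bipartite_subgraph n (m n)}"
        unfolding S_def
        by (intro prob_hub_strategy_ge) (simp_all add: \<open>k n \<le> n\<close> \<open>m n \<le> N\<close>, simp add: k_def)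
      also have "\<dots> \<le> prob (?good n)"
      proof (rule finite_measure_mono)
        have "real N \<le> (1 + \<epsilon> n) * m n"
          unfolding N_def using \<epsilon>0 by (simp add: of_nat_nat)
        then show "{\<omega>. graph_after n N \<omega> \<in> has_bipartite_subgraph n (m n)} \<subseteq> ?good n"
          unfolding rounds_needed_le_iff by auto
        show "?good n \<in> events"
          unfolding rounds_needed_le_iff
          by (intro sets.sets_Collect_countable_Ex sets.sets_Collect_conj sets.sets_Collect_const
              pred_graph_after[unfolded pred_def])
      qed
      finally show ?case .
    qed
  qed
  moreover have "(\<lambda>n. 1 - 2 * \<epsilon> n) \<longlonglongrightarrow> 1 - 2 * 0"
    by (intro tendsto_intros \<epsilon>)
  moreover have "\<forall>\<^sub>F n in sequentially. measure (semi_random_process n (S n)) (?good n) \<le> 1"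
    by (intro always_eventually allI prob_space.prob_le_1 prob_space_process)
  ultimately have "(\<lambda>n. measure (semi_random_process n (S n)) (?good n)) \<longlonglongrightarrow> 1"
    using tendsto_sandwich[where f="\<lambda>n. 1 - 2 * \<epsilon> n" and h="\<lambda>_. 1", OF _ _ _ tendsto_const]
    by (simp only: mult_zero_right diff_zero)
  then have upper: "aas S (\<lambda>n \<omega>. ereal_of_enat (rounds_needed n (has_bipartite_subgraph n (m n)) \<omega>)
      \<le> ereal ((1 + \<epsilon> n) * real (m n)))"
    by (simp only: aas_def)

  \<comment> \<open>The hub strategy ignores the offered vertex, so the same witness serves both
    processes.\<close>
  have "S n \<in> pre_positional n" "S n \<in> post_positional n" "deterministic (S n)" for n
    using hub_strategy_pre_positional[of "k n" n] hub_strategy_deterministic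
    by (auto simp: S_def pre_positional_def)
  with lower upper \<epsilon> show ?thesis
    by (intro ballI conjI exI[of _ S] exI[of _ \<epsilon>]) auto
qed

end
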